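(* Let $(A,\cdot_A,\Delta_r)$ be a factorizable perm bialgebra. Let $T_r\oplus T_{\sigma(r)}:A^*\to A\oplus A$ be the linear map $a^*\mapsto (T_r(a^* ),T_{\sigma(r)}(a^* ))$. Then $\mathrm{Im}(T_r\oplus T_{\sigma(r)})$ is a perm subalgebra of the direct sum perm algebra $A\oplus A$, and it is isomorphic to the perm algebra $(A^*,\cdot_r)$, where $\cdot_r:A^*\otimes A^*\to A^*$ is defined by $$a^*\cdot_r b^*=L^*(T_r(a^* ))b^*+\mathrm{ad}^*(T_{\sigma(r)}(b^* ))a^*,\quad \forall a^*,b^*\in A^*.$$ Moreover, any $a\in A$ has a unique decomposition $a=a_1-a_2$ with $(a_1,a_2)\in \mathrm{Im}(T_r\oplus T_{\sigma(r)})$.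
   Context: Conventions: the base field $\mathbb K$ has characteristic zero; all vector spaces and algebras are finite-dimensional. For a bilinear operation $\cdot_A$ on $A$: $L(a)b=a\cdot_A b$, $R(a)b=b\cdot_A a$, $\mathrm{ad}(a)=L(a)-R(a)$. For $\mu:A\to\mathrm{End}(V)$, $\mu^*:A\to\mathrm{End}(V^* )$ is $\langle\mu^*(a)v^*,v\rangle=\langle v^*,\mu(a)v\rangle$ (no sign). $\sigma(u\otimes v)=v\otimes u$. Perm algebra: a vector space $A$ with bilinear $\cdot_A$ such that $a\cdot_A(b\cdot_A c)=(a\cdot_A b)\cdot_A c=(b\cdot_A a)\cdot_A c$ for all $a,b,c\in A$. The direct sum perm algebra $A\oplus A$ has componentwise multiplication. Perm coalgebra: $(A,\Delta)$ with $\Delta:A\to A\otimes A$ linear and $(\Delta\otimes\mathrm{id})\Delta=(\mathrm{id}\otimes\Delta)\Delta=(\sigma\otimes\mathrm{id})(\Delta\otimes\mathrm{id})\Delta$. Perm bialgebra: $(A,\cdot_A,\Delta)$ with $(A,\cdot_A)$ a perm algebra, $(A,\Delta)$ a perm coalgebra, and for all $a,b\in A$: $\Delta(a\cdot_A b)=(\mathrm{ad}(a)\otimes\mathrm{id})\Delta(b)+(\mathrm{id}\otimes R(b))\Delta(a)$; $\sigma(R(b)\otimes\mathrm{id})\Delta(a)=(R(a)\otimes\mathrm{id})\Delta(b)$; $\Delta(a\cdot_A b)=(\mathrm{id}\otimes L(a))\Delta(b)+(\mathrm{ad}(b)\otimes\mathrm{id})(\Delta(a)-\sigma\Delta(a))$.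 For $r=\sum_i a_i\otimes b_i\in A\otimes A$: $T_r:A^*\to A$ is defined by $\langle T_r(a^* ),b^*\rangle=\langle r,a^*\otimes b^*\rangle$, i.e. $T_r(a^* )=\sum_i\langle a^*,a_i\rangle b_i$; and $\Delta_r(a)=(\mathrm{id}\otimes R(a)-\mathrm{ad}(a)\otimes\mathrm{id})(r)$. $r$ is a solution of the perm Yang-Baxter equation in $(A,\cdot_A)$ if $[[r,r]]:=\sum_{i,j}\big(a_i\otimes b_i\cdot_A a_j\otimes b_j-a_i\otimes a_j\otimes b_i\cdot_A b_j+a_i\cdot_A a_j\otimes b_i\otimes b_j-a_j\cdot_A a_i\otimes b_i\otimes b_j\big)=0$. An element $s\in A\otimes A$ is $(R,\mathrm{ad})$-invariant if $(\mathrm{id}\otimes R(a)-\mathrm{ad}(a)\otimes\mathrm{id})(s)=0$ for all $a\in A$. Quasi-triangular perm bialgebra: a perm bialgebra $(A,\cdot_A,\Delta_r)$ where $r$ solves the perm Yang-Baxter equation and the skew-symmetric part $\frac12(r-\sigma(r))$ is $(R,\mathrm{ad})$-invariant. It is factorizable if moreover $T_{r-\sigma(r)}:A^*\to A$ is a linear isomorphism. *)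

theory Defs
  imports Complex_Main "HOL-Library.Poly_Mapping" "HOL-Library.Function_Algebras"
    "HOL-Library.Product_Plus"
begin

text \<open>
  The space \<open>A\<close> is a type \<open>'v\<close> with scalar multiplication \<open>s\<close>. The dual space, subalgebras and
  direct sums are subspaces of vector spaces built from \<open>'v\<close>, so the algebraic notions carry an
  explicit carrier set.
\<close>

section \<open>Linear algebra on subspaces\<close>

definition linear_map_on ::
  "('k \<Rightarrow> 'u::ab_group_add \<Rightarrow> 'u) \<Rightarrow> ('k \<Rightarrow> 'w::ab_group_add \<Rightarrow> 'w) \<Rightarrow> 'u set \<Rightarrow> ('u \<Rightarrow> 'w) \<Rightarrow> bool"
  where "linear_map_on s1 s2 S f \<longleftrightarrow>
    (\<forall>x\<in>S. \<forall>y\<in>S. f (x + y) = f x + f y) \<and> (\<forall>c. \<forall>x\<in>S. f (s1 c x) = s2 c (f x))"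

definition bilinear_on :: "('k \<Rightarrow> 'u::ab_group_add \<Rightarrow> 'u) \<Rightarrow> 'u set \<Rightarrow> ('u \<Rightarrow> 'u \<Rightarrow> 'u) \<Rightarrow> bool"
  where "bilinear_on s S m \<longleftrightarrow>
    (\<forall>x\<in>S. linear_map_on s s S (\<lambda>y. m x y)) \<and> (\<forall>y\<in>S. linear_map_on s s S (\<lambda>x. m x y))"

definition fun_scale :: "'k::field \<Rightarrow> ('v \<Rightarrow> 'k) \<Rightarrow> 'v \<Rightarrow> 'k"
  where "fun_scale c f = (\<lambda>x. c * f x)"

definition prod_scale :: "('k \<Rightarrow> 'v \<Rightarrow> 'v) \<Rightarrow> 'k \<Rightarrow> 'v \<times> 'v \<Rightarrow> 'v \<times> 'v"
  where "prod_scale s c p = (s c (fst p), s c (snd p))"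

definition dual_space :: "('k::field \<Rightarrow> 'v::ab_group_add \<Rightarrow> 'v) \<Rightarrow> ('v \<Rightarrow> 'k) set"
  where "dual_space s = {f. Vector_Spaces.linear s (*) f}"

text \<open>The transpose of an operator, without sign.\<close>

definition transpose_op :: "('v \<Rightarrow> 'v) \<Rightarrow> ('v \<Rightarrow> 'k) \<Rightarrow> 'v \<Rightarrow> 'k"
  where "transpose_op g f = (\<lambda>x. f (g x))"

section \<open>Perm algebras\<close>

definition perm_algebra :: "('k::field \<Rightarrow> 'u::ab_group_add \<Rightarrow> 'u) \<Rightarrow> 'u set \<Rightarrow> ('u \<Rightarrow> 'u \<Rightarrow> 'u) \<Rightarrow> bool"
  where "perm_algebra s S m \<longleftrightarrow>
    vector_space s \<and> module.subspace s S \<and>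
    (\<forall>a\<in>S. \<forall>b\<in>S. m a b \<in> S) \<and> bilinear_on s S m \<and>
    (\<forall>a\<in>S. \<forall>b\<in>S. \<forall>c\<in>S. m a (m b c) = m (m a b) c \<and> m (m a b) c = m (m b a) c)"

definition perm_subalgebra ::
  "('k::field \<Rightarrow> 'u::ab_group_add \<Rightarrow> 'u) \<Rightarrow> 'u set \<Rightarrow> ('u \<Rightarrow> 'u \<Rightarrow> 'u) \<Rightarrow> 'u set \<Rightarrow> bool"
  where "perm_subalgebra s S m H \<longleftrightarrow>
    perm_algebra s S m \<and> H \<subseteq> S \<and> module.subspace s H \<and> (\<forall>a\<in>H. \<forall>b\<in>H. m a b \<in> H)"

definition perm_isomorphic ::
  "('k::field \<Rightarrow> 'u::ab_group_add \<Rightarrow> 'u) \<Rightarrow> 'u set \<Rightarrow> ('u \<Rightarrow> 'u \<Rightarrow> 'u) \<Rightarrow>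
   ('k \<Rightarrow> 'w::ab_group_add \<Rightarrow> 'w) \<Rightarrow> 'w set \<Rightarrow> ('w \<Rightarrow> 'w \<Rightarrow> 'w) \<Rightarrow> bool"
  where "perm_isomorphic s1 S1 m1 s2 S2 m2 \<longleftrightarrow>
    (\<exists>f. linear_map_on s1 s2 S1 f \<and> bij_betw f S1 S2 \<and>
         (\<forall>a\<in>S1. \<forall>b\<in>S1. f (m1 a b) = m2 (f a) (f b)))"

definition sum_mult :: "('v \<Rightarrow> 'v \<Rightarrow> 'v) \<Rightarrow> 'v \<times> 'v \<Rightarrow> 'v \<times> 'v \<Rightarrow> 'v \<times> 'v"
  where "sum_mult m p q = (m (fst p) (fst q), m (snd p) (snd q))"

definition L_op :: "('v \<Rightarrow> 'v \<Rightarrow> 'v) \<Rightarrow> 'v \<Rightarrow> 'v \<Rightarrow> 'v"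
  where "L_op m a b = m a b"

definition R_op :: "('v \<Rightarrow> 'v \<Rightarrow> 'v) \<Rightarrow> 'v \<Rightarrow> 'v \<Rightarrow> 'v"
  where "R_op m a b = m b a"

definition ad_op :: "('v \<Rightarrow> 'v \<Rightarrow> 'v::ab_group_add) \<Rightarrow> 'v \<Rightarrow> 'v \<Rightarrow> 'v"
  where "ad_op m a b = L_op m a b - R_op m a b"

section \<open>Tensors\<close>

text \<open>
  \<open>A \<otimes> A\<close> is the quotient of the free vector space on \<open>A \<times> A\<close> by the subspace spanned by the
  bilinearity relators, and \<open>A \<otimes> A \<otimes> A\<close> is the analogous quotient for trilinearity. Since the
  relators depend on \<open>s\<close>, the quotients are not formed as types: a tensor is given by a
  representative in the free vector space, and equality of tensors is congruence modulo the
  relators (\<open>tensor2_eq\<close>, \<open>tensor3_eq\<close>). The lemmas below show that the operations respect it.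
\<close>

definition free_scale :: "'k::field \<Rightarrow> ('b \<Rightarrow>\<^sub>0 'k) \<Rightarrow> ('b \<Rightarrow>\<^sub>0 'k)"
  where "free_scale c x = Poly_Mapping.map ((*) c) x"

definition gen :: "'b \<Rightarrow> ('b \<Rightarrow>\<^sub>0 'k::field)"
  where "gen p = Poly_Mapping.single p 1"

definition lin_ext :: "('k::field \<Rightarrow> 'w::ab_group_add \<Rightarrow> 'w) \<Rightarrow> ('b \<Rightarrow> 'w) \<Rightarrow> ('b \<Rightarrow>\<^sub>0 'k) \<Rightarrow> 'w"
  where "lin_ext t f x = (\<Sum>p\<in>Poly_Mapping.keys x. t (Poly_Mapping.lookup x p) (f p))"

definition tensor2_null :: "('k::field \<Rightarrow> 'v::ab_group_add \<Rightarrow> 'v) \<Rightarrow> ('v \<times> 'v \<Rightarrow>\<^sub>0 'k) set"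
  where "tensor2_null s = module.span free_scale
    ({gen (a + a', b) - gen (a, b) - gen (a', b) | a a' b. True} \<union>
     {gen (a, b + b') - gen (a, b) - gen (a, b') | a b b'. True} \<union>
     {gen (s c a, b) - free_scale c (gen (a, b)) | c a b. True} \<union>
     {gen (a, s c b) - free_scale c (gen (a, b)) | c a b. True})"

definition tensor3_null :: "('k::field \<Rightarrow> 'v::ab_group_add \<Rightarrow> 'v) \<Rightarrow> ('v \<times> 'v \<times> 'v \<Rightarrow>\<^sub>0 'k) set"
  where "tensor3_null s = module.span free_scale
    ({gen (a + a', b, d) - gen (a, b, d) - gen (a', b, d) | a a' b d. True} \<union>
     {gen (a, b + b', d) - gen (a, b, d) - gen (a, b', d) | a b b' d. True} \<union>
     {gen (a, b, d + d') - gen (a, b, d) - gen (a, b, d') | a b d d'. True} \<union>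
     {gen (s c a, b, d) - free_scale c (gen (a, b, d)) | c a b d. True} \<union>
     {gen (a, s c b, d) - free_scale c (gen (a, b, d)) | c a b d. True} \<union>
     {gen (a, b, s c d) - free_scale c (gen (a, b, d)) | c a b d. True})"

definition tensor2_eq ::
  "('k::field \<Rightarrow> 'v::ab_group_add \<Rightarrow> 'v) \<Rightarrow> ('v \<times> 'v \<Rightarrow>\<^sub>0 'k) \<Rightarrow> ('v \<times> 'v \<Rightarrow>\<^sub>0 'k) \<Rightarrow> bool"
  where "tensor2_eq s x y \<longleftrightarrow> x - y \<in> tensor2_null s"

definition tensor3_eq ::
  "('k::field \<Rightarrow> 'v::ab_group_add \<Rightarrow> 'v) \<Rightarrow> ('v \<times> 'v \<times> 'v \<Rightarrow>\<^sub>0 'k) \<Rightarrow> ('v \<times> 'v \<times> 'v \<Rightarrow>\<^sub>0 'k) \<Rightarrow> bool"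
  where "tensor3_eq s x y \<longleftrightarrow> x - y \<in> tensor3_null s"

text \<open>\<open>f \<otimes> g\<close>, the flip \<open>\<sigma>\<close>, \<open>\<Delta> \<otimes> id\<close>, \<open>id \<otimes> \<Delta>\<close> and \<open>\<sigma> \<otimes> id\<close>.\<close>

definition tmap :: "('v \<Rightarrow> 'v) \<Rightarrow> ('v \<Rightarrow> 'v) \<Rightarrow> ('v \<times> 'v \<Rightarrow>\<^sub>0 'k::field) \<Rightarrow> ('v \<times> 'v \<Rightarrow>\<^sub>0 'k)"
  where "tmap f g = lin_ext free_scale (\<lambda>(a, b). gen (f a, g b))"

definition tflip :: "('v \<times> 'v \<Rightarrow>\<^sub>0 'k::field) \<Rightarrow> ('v \<times> 'v \<Rightarrow>\<^sub>0 'k)"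
  where "tflip = lin_ext free_scale (\<lambda>(a, b). gen (b, a))"

definition comul_id ::
  "('v \<Rightarrow> ('v \<times> 'v \<Rightarrow>\<^sub>0 'k::field)) \<Rightarrow> ('v \<times> 'v \<Rightarrow>\<^sub>0 'k) \<Rightarrow> ('v \<times> 'v \<times> 'v \<Rightarrow>\<^sub>0 'k)"
  where "comul_id D =
    lin_ext free_scale (\<lambda>(a, b). lin_ext free_scale (\<lambda>(u, v). gen (u, v, b)) (D a))"

definition id_comul ::
  "('v \<Rightarrow> ('v \<times> 'v \<Rightarrow>\<^sub>0 'k::field)) \<Rightarrow> ('v \<times> 'v \<Rightarrow>\<^sub>0 'k) \<Rightarrow> ('v \<times> 'v \<times> 'v \<Rightarrow>\<^sub>0 'k)"
  where "id_comul D =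
    lin_ext free_scale (\<lambda>(a, b). lin_ext free_scale (\<lambda>(u, v). gen (a, u, v)) (D b))"

definition flip_id :: "('v \<times> 'v \<times> 'v \<Rightarrow>\<^sub>0 'k::field) \<Rightarrow> ('v \<times> 'v \<times> 'v \<Rightarrow>\<^sub>0 'k)"
  where "flip_id = lin_ext free_scale (\<lambda>(a, b, d). gen (b, a, d))"

section \<open>Perm coalgebras and perm bialgebras\<close>

definition tensor2_linear ::
  "('k::field \<Rightarrow> 'v::ab_group_add \<Rightarrow> 'v) \<Rightarrow> ('v \<Rightarrow> ('v \<times> 'v \<Rightarrow>\<^sub>0 'k)) \<Rightarrow> bool"
  where "tensor2_linear s D \<longleftrightarrow>
    (\<forall>a b. tensor2_eq s (D (a + b)) (D a + D b)) \<and>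
    (\<forall>c a. tensor2_eq s (D (s c a)) (free_scale c (D a)))"

definition perm_coalgebra ::
  "('k::field \<Rightarrow> 'v::ab_group_add \<Rightarrow> 'v) \<Rightarrow> ('v \<Rightarrow> ('v \<times> 'v \<Rightarrow>\<^sub>0 'k)) \<Rightarrow> bool"
  where "perm_coalgebra s D \<longleftrightarrow>
    vector_space s \<and> tensor2_linear s D \<and>
    (\<forall>a. tensor3_eq s (comul_id D (D a)) (id_comul D (D a)) \<and>
         tensor3_eq s (id_comul D (D a)) (flip_id (comul_id D (D a))))"

definition perm_bialgebra ::
  "('k::field \<Rightarrow> 'v::ab_group_add \<Rightarrow> 'v) \<Rightarrow> ('v \<Rightarrow> 'v \<Rightarrow> 'v) \<Rightarrow> ('v \<Rightarrow> ('v \<times> 'v \<Rightarrow>\<^sub>0 'k)) \<Rightarrow> bool"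
  where "perm_bialgebra s m D \<longleftrightarrow>
    perm_algebra s UNIV m \<and> perm_coalgebra s D \<and>
    (\<forall>a b. tensor2_eq s (D (m a b))
             (tmap (ad_op m a) id (D b) + tmap id (R_op m b) (D a))) \<and>
    (\<forall>a b. tensor2_eq s (tflip (tmap (R_op m b) id (D a)))
             (tmap (R_op m a) id (D b))) \<and>
    (\<forall>a b. tensor2_eq s (D (m a b))
             (tmap id (L_op m a) (D b) + tmap (ad_op m b) id (D a - tflip (D a))))"

definition T_map ::
  "('k::field \<Rightarrow> 'v::ab_group_add \<Rightarrow> 'v) \<Rightarrow> ('v \<times> 'v \<Rightarrow>\<^sub>0 'k) \<Rightarrow> ('v \<Rightarrow> 'k) \<Rightarrow> 'v"
  where "T_map s r f = lin_ext s (\<lambda>(a, b). s (f a) b) r"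

definition R_ad_action ::
  "('v::ab_group_add \<Rightarrow> 'v \<Rightarrow> 'v) \<Rightarrow> 'v \<Rightarrow> ('v \<times> 'v \<Rightarrow>\<^sub>0 'k::field) \<Rightarrow> ('v \<times> 'v \<Rightarrow>\<^sub>0 'k)"
  where "R_ad_action m a x = tmap id (R_op m a) x - tmap (ad_op m a) id x"

definition coboundary ::
  "('v::ab_group_add \<Rightarrow> 'v \<Rightarrow> 'v) \<Rightarrow> ('v \<times> 'v \<Rightarrow>\<^sub>0 'k::field) \<Rightarrow> 'v \<Rightarrow> ('v \<times> 'v \<Rightarrow>\<^sub>0 'k)"
  where "coboundary m r a = R_ad_action m a r"

definition R_ad_invariant ::
  "('k::field \<Rightarrow> 'v::ab_group_add \<Rightarrow> 'v) \<Rightarrow> ('v \<Rightarrow> 'v \<Rightarrow> 'v) \<Rightarrow> ('v \<times> 'v \<Rightarrow>\<^sub>0 'k) \<Rightarrow> bool"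
  where "R_ad_invariant s m x \<longleftrightarrow> (\<forall>a. tensor2_eq s (R_ad_action m a x) 0)"

text \<open>The element \<open>[[r, r]]\<close>; \<open>(a, b)\<close> and \<open>(c, d)\<close> range over the terms
  \<open>a\<^sub>i \<otimes> b\<^sub>i\<close> and \<open>a\<^sub>j \<otimes> b\<^sub>j\<close> of \<open>r\<close>, weighted by their coefficients.\<close>

definition perm_YB ::
  "('v \<Rightarrow> 'v \<Rightarrow> 'v) \<Rightarrow> ('v \<times> 'v \<Rightarrow>\<^sub>0 'k::field) \<Rightarrow> ('v \<times> 'v \<times> 'v \<Rightarrow>\<^sub>0 'k)"
  where "perm_YB m r =
    lin_ext free_scale (\<lambda>(a, b). lin_ext free_scale (\<lambda>(c, d).
      gen (a, m b c, d) - gen (a, c, m b d) + gen (m a c, b, d) - gen (m c a, b, d)) r) r"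

definition perm_YBE_solution ::
  "('k::field \<Rightarrow> 'v::ab_group_add \<Rightarrow> 'v) \<Rightarrow> ('v \<Rightarrow> 'v \<Rightarrow> 'v) \<Rightarrow> ('v \<times> 'v \<Rightarrow>\<^sub>0 'k) \<Rightarrow> bool"
  where "perm_YBE_solution s m r \<longleftrightarrow> tensor3_eq s (perm_YB m r) 0"

definition quasi_triangular_perm_bialgebra ::
  "('k::field \<Rightarrow> 'v::ab_group_add \<Rightarrow> 'v) \<Rightarrow> ('v \<Rightarrow> 'v \<Rightarrow> 'v) \<Rightarrow> ('v \<times> 'v \<Rightarrow>\<^sub>0 'k) \<Rightarrow> bool"
  where "quasi_triangular_perm_bialgebra s m r \<longleftrightarrow>
    perm_bialgebra s m (coboundary m r) \<and> perm_YBE_solution s m r \<and>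
    R_ad_invariant s m (free_scale (1/2) (r - tflip r))"

definition factorizable_perm_bialgebra ::
  "('k::field \<Rightarrow> 'v::ab_group_add \<Rightarrow> 'v) \<Rightarrow> ('v \<Rightarrow> 'v \<Rightarrow> 'v) \<Rightarrow> ('v \<times> 'v \<Rightarrow>\<^sub>0 'k) \<Rightarrow> bool"
  where "factorizable_perm_bialgebra s m r \<longleftrightarrow>
    quasi_triangular_perm_bialgebra s m r \<and>
    linear_map_on fun_scale s (dual_space s) (T_map s (r - tflip r)) \<and>
    bij_betw (T_map s (r - tflip r)) (dual_space s) UNIV"

definition T_sum ::
  "('k::field \<Rightarrow> 'v::ab_group_add \<Rightarrow> 'v) \<Rightarrow> ('v \<times> 'v \<Rightarrow>\<^sub>0 'k) \<Rightarrow> ('v \<Rightarrow> 'k) \<Rightarrow> 'v \<times> 'v"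
  where "T_sum s r f = (T_map s r f, T_map s (tflip r) f)"

definition dual_mult ::
  "('k::field \<Rightarrow> 'v::ab_group_add \<Rightarrow> 'v) \<Rightarrow> ('v \<Rightarrow> 'v \<Rightarrow> 'v) \<Rightarrow> ('v \<times> 'v \<Rightarrow>\<^sub>0 'k) \<Rightarrow>
   ('v \<Rightarrow> 'k) \<Rightarrow> ('v \<Rightarrow> 'k) \<Rightarrow> ('v \<Rightarrow> 'k)"
  where "dual_mult s m r f g =
    transpose_op (L_op m (T_map s r f)) g + transpose_op (ad_op m (T_map s (tflip r) g)) f"

section \<open>Compatibility of the operations with equality of tensors\<close>

lemma lookup_free_scale [simp]: "Poly_Mapping.lookup (free_scale c x) p = c * Poly_Mapping.lookup x p"
  by (simp add: free_scale_def Poly_Mapping.map.rep_eq when_def)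

lemma vector_space_free_scale: "vector_space (free_scale :: 'k::field \<Rightarrow> ('b \<Rightarrow>\<^sub>0 'k) \<Rightarrow> _)"
  by unfold_locales (auto intro!: poly_mapping_eqI simp: lookup_add algebra_simps)

lemma module_free_scale: "module (free_scale :: 'k::field \<Rightarrow> ('b \<Rightarrow>\<^sub>0 'k) \<Rightarrow> _)"
  using vector_space_free_scale by (simp add: module_iff_vector_space)

lemma lin_ext_superset:
  assumes "vector_space t" "finite K" "Poly_Mapping.keys x \<subseteq> K"
  shows "lin_ext t f x = (\<Sum>p\<in>K. t (Poly_Mapping.lookup x p) (f p))"
proof -
  interpret vector_space t by fact
  show ?thesis unfolding lin_ext_def
    using assms(2,3) by (intro sum.mono_neutral_left) (auto simp: in_keys_iff)
qed

lemma linear_lin_ext: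
  assumes "vector_space t"
  shows "Vector_Spaces.linear free_scale t (lin_ext t f)"
proof -
  interpret t: vector_space t by fact
  have add: "lin_ext t f (x + y) = lin_ext t f x + lin_ext t f y" for x y
  proof -
    let ?K = "Poly_Mapping.keys x \<union> Poly_Mapping.keys y"
    have "Poly_Mapping.keys (x + y) \<subseteq> ?K" by (rule Poly_Mapping.keys_add)
    then show ?thesis
      by (simp add: lin_ext_superset[OF assms, of ?K] lookup_add t.scale_left_distrib sum.distrib)
  qed
  have scl: "lin_ext t f (free_scale c x) = t c (lin_ext t f x)" for c x
  proof -
    have "Poly_Mapping.keys (free_scale c x) \<subseteq> Poly_Mapping.keys x"
      by (auto simp: in_keys_iff)
    then show ?thesis
      by (simp add: lin_ext_superset[OF assms, of "Poly_Mapping.keys x"] t.scale_sum_right)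
  qed
  show ?thesis
    unfolding Vector_Spaces.linear_def module_hom_def module_hom_axioms_def
    using assms vector_space_free_scale add scl
    by (auto simp: module_def vector_space_def)
qed

lemma linear_imp_module_hom: "Vector_Spaces.linear s1 s2 f \<Longrightarrow> module_hom s1 s2 f"
  by (simp add: Vector_Spaces.linear_def)

lemma lin_ext_gen [simp]: "vector_space t \<Longrightarrow> lin_ext t f (gen p) = f p"
  by (simp add: lin_ext_def gen_def vector_space_def)

lemma lin_ext_span:
  assumes t: "vector_space t" and N: "module.subspace t N"
    and x: "x \<in> module.span free_scale B" and B: "\<And>b. b \<in> B \<Longrightarrow> lin_ext t f b \<in> N"
  shows "lin_ext t f x \<in> N"
proof -
  interpret t: vector_space t by fact
  interpret F: vector_space "free_scale :: 'a \<Rightarrow> ('c \<Rightarrow>\<^sub>0 'a) \<Rightarrow> ('c \<Rightarrow>\<^sub>0 'a)" by (rule vector_space_free_scale)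
  interpret l: Vector_Spaces.linear free_scale t "lin_ext t f" by (rule linear_lin_ext[OF t])
  show ?thesis using x
    by (induction rule: F.span_induct_alt)
      (auto simp: l.add l.scale t.subspace_0[OF N] intro!: t.subspace_add[OF N] t.subspace_scale[OF N] B)
qed

lemma tensor2_eq_lin_ext:
  fixes s :: "'k::field \<Rightarrow> 'v::ab_group_add \<Rightarrow> 'v"
  assumes t: "vector_space t" and N: "module.subspace t N"
    and f: "\<And>a a' b. f (a + a', b) - f (a, b) - f (a', b) \<in> N"
      "\<And>a b b'. f (a, b + b') - f (a, b) - f (a, b') \<in> N"
      "\<And>c a b. f (s c a, b) - t c (f (a, b)) \<in> N"
      "\<And>c a b. f (a, s c b) - t c (f (a, b)) \<in> N"
    and xy: "tensor2_eq s x y"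
  shows "lin_ext t f x - lin_ext t f y \<in> N"
proof -
  interpret l: Vector_Spaces.linear free_scale t "lin_ext t f" by (rule linear_lin_ext[OF t])
  have "lin_ext t f (x - y) \<in> N"
    by (rule lin_ext_span[OF t N xy[unfolded tensor2_eq_def tensor2_null_def]])
      (auto simp: l.diff l.scale t f)
  then show ?thesis by (simp add: l.diff)
qed

lemma tensor3_eq_lin_ext:
  fixes s :: "'k::field \<Rightarrow> 'v::ab_group_add \<Rightarrow> 'v"
  assumes t: "vector_space t" and N: "module.subspace t N"
    and f: "\<And>a a' b d. f (a + a', b, d) - f (a, b, d) - f (a', b, d) \<in> N"
      "\<And>a b b' d. f (a, b + b', d) - f (a, b, d) - f (a, b', d) \<in> N"
      "\<And>a b d d'. f (a, b, d + d') - f (a, b, d) - f (a, b, d') \<in> N"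
      "\<And>c a b d. f (s c a, b, d) - t c (f (a, b, d)) \<in> N"
      "\<And>c a b d. f (a, s c b, d) - t c (f (a, b, d)) \<in> N"
      "\<And>c a b d. f (a, b, s c d) - t c (f (a, b, d)) \<in> N"
    and xy: "tensor3_eq s x y"
  shows "lin_ext t f x - lin_ext t f y \<in> N"
proof -
  interpret l: Vector_Spaces.linear free_scale t "lin_ext t f" by (rule linear_lin_ext[OF t])
  have "lin_ext t f (x - y) \<in> N"
    by (rule lin_ext_span[OF t N xy[unfolded tensor3_eq_def tensor3_null_def]])
      (auto simp: l.diff l.scale t f)
  then show ?thesis by (simp add: l.diff)
qed

lemma T_map_cong:
  fixes s :: "'k::field \<Rightarrow> 'v::ab_group_add \<Rightarrow> 'v"
  assumes s: "vector_space s" and f: "f \<in> dual_space s" and xy: "tensor2_eq s x y"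
  shows "T_map s x f = T_map s y f"
proof -
  interpret vector_space s by fact
  interpret l: Vector_Spaces.linear s "(*)" f using f by (simp add: dual_space_def)
  have "lin_ext s (\<lambda>(a, b). s (f a) b) x - lin_ext s (\<lambda>(a, b). s (f a) b) y \<in> {0}"
    by (rule tensor2_eq_lin_ext[OF s _ _ _ _ _ xy])
      (auto simp: subspace_single_0 l.add l.scale algebra_simps)
  then show ?thesis by (simp add: T_map_def)
qed

lemma subspace_tensor2_null: "module.subspace free_scale (tensor2_null s)"
  unfolding tensor2_null_def by (rule module.subspace_span[OF module_free_scale])

lemma subspace_tensor3_null: "module.subspace free_scale (tensor3_null s)"
  unfolding tensor3_null_def by (rule module.subspace_span[OF module_free_scale])

lemma tensor2_null_gen:
  "gen (a + a', b) - gen (a, b) - gen (a', b) \<in> tensor2_null s"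
  "gen (a, b + b') - gen (a, b) - gen (a, b') \<in> tensor2_null s"
  "gen (s c a, b) - free_scale c (gen (a, b)) \<in> tensor2_null s"
  "gen (a, s c b) - free_scale c (gen (a, b)) \<in> tensor2_null s"
  unfolding tensor2_null_def proof - qed (rule module.span_base[OF module_free_scale]; blast)+

lemma tensor3_null_gen:
  "gen (a + a', b, d) - gen (a, b, d) - gen (a', b, d) \<in> tensor3_null s"
  "gen (a, b + b', d) - gen (a, b, d) - gen (a, b', d) \<in> tensor3_null s"
  "gen (a, b, d + d') - gen (a, b, d) - gen (a, b, d') \<in> tensor3_null s"
  "gen (s c a, b, d) - free_scale c (gen (a, b, d)) \<in> tensor3_null s"
  "gen (a, s c b, d) - free_scale c (gen (a, b, d)) \<in> tensor3_null s"
  "gen (a, b, s c d) - free_scale c (gen (a, b, d)) \<in> tensor3_null s"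
  unfolding tensor3_null_def proof - qed (rule module.span_base[OF module_free_scale]; unfold Un_iff mem_Collect_eq; fast)+

lemma tmap_cong:
  assumes f: "Vector_Spaces.linear s s f" and g: "Vector_Spaces.linear s s g"
    and xy: "tensor2_eq s x y"
  shows "tensor2_eq s (tmap f g x) (tmap f g y)"
proof -
  interpret f: Vector_Spaces.linear s s f by fact
  interpret g: Vector_Spaces.linear s s g by fact
  show ?thesis unfolding tmap_def tensor2_eq_def
    by (rule tensor2_eq_lin_ext[OF vector_space_free_scale subspace_tensor2_null _ _ _ _ xy])
      (simp_all add: f.add f.scale g.add g.scale tensor2_null_gen)
qed

lemma tflip_cong: "tensor2_eq s x y \<Longrightarrow> tensor2_eq s (tflip x) (tflip y)"
  unfolding tflip_def tensor2_eq_def[of s "lin_ext _ _ _"]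
  by (rule tensor2_eq_lin_ext[OF vector_space_free_scale subspace_tensor2_null])
    (simp_all add: tensor2_null_gen)

lemma flip_id_cong: "tensor3_eq s x y \<Longrightarrow> tensor3_eq s (flip_id x) (flip_id y)"
  unfolding flip_id_def tensor3_eq_def[of s "lin_ext _ _ _"]
  by (rule tensor3_eq_lin_ext[OF vector_space_free_scale subspace_tensor3_null])
    (simp_all add: tensor3_null_gen)

lemma lin_ext_mem:
  assumes "vector_space t" "module.subspace t N" "\<And>p. f p \<in> N"
  shows "lin_ext t f x \<in> N"
proof -
  interpret vector_space t by fact
  show ?thesis unfolding lin_ext_def
    by (intro subspace_sum[OF assms(2)] subspace_scale[OF assms(2)] assms(3))
qed

lemma lin_ext_fun:
  assumes "vector_space t"
  shows "lin_ext t (\<lambda>p. f p - g p) x = lin_ext t f x - lin_ext t g x"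
    and "lin_ext t (\<lambda>p. t c (f p)) x = t c (lin_ext t f x)"
proof -
  interpret vector_space t by fact
  show "lin_ext t (\<lambda>p. f p - g p) x = lin_ext t f x - lin_ext t g x"
    by (simp add: lin_ext_def scale_right_diff_distrib sum_subtractf)
  show "lin_ext t (\<lambda>p. t c (f p)) x = t c (lin_ext t f x)"
    by (simp add: lin_ext_def scale_sum_right mult.commute)
qed

lemma lin_ext_cong_mod:
  assumes "vector_space t" "module.subspace t N" "\<And>p. f p - g p \<in> N"
  shows "lin_ext t f x - lin_ext t g x \<in> N"
  using lin_ext_mem[OF assms(1,2), of "\<lambda>p. f p - g p"] assms(3)
  by (simp add: lin_ext_fun[OF assms(1)])

lemma tensor2_eq_gen3:
  assumes "tensor2_eq s x y"
  shows "lin_ext free_scale (\<lambda>(u, v). gen (u, v, b)) x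
      - lin_ext free_scale (\<lambda>(u, v). gen (u, v, b)) y \<in> tensor3_null s"
    and "lin_ext free_scale (\<lambda>(u, v). gen (b, u, v)) x
      - lin_ext free_scale (\<lambda>(u, v). gen (b, u, v)) y \<in> tensor3_null s"
proof -
qed (rule tensor2_eq_lin_ext[OF vector_space_free_scale subspace_tensor3_null _ _ _ _ assms];
      simp add: tensor3_null_gen)+

lemma comul_cong:
  assumes D: "tensor2_linear s D" and xy: "tensor2_eq s x y"
  shows "tensor3_eq s (comul_id D x) (comul_id D y)"
    and "tensor3_eq s (id_comul D x) (id_comul D y)"
proof -
  note sub = vector_space_free_scale subspace_tensor3_null
  note hom = linear_lin_ext[OF vector_space_free_scale, THEN linear_imp_module_hom]
  have D1: "tensor2_eq s (D (a + a')) (D a + D a')" "tensor2_eq s (D (s c a)) (free_scale c (D a))"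
    for a a' c using D by (auto simp: tensor2_linear_def)
  note g1 = tensor2_eq_gen3(1)[OF D1(1)] tensor2_eq_gen3(1)[OF D1(2)]
  note g2 = tensor2_eq_gen3(2)[OF D1(1)] tensor2_eq_gen3(2)[OF D1(2)]
  show "tensor3_eq s (comul_id D x) (comul_id D y)"
    unfolding comul_id_def tensor3_eq_def
  proof (rule tensor2_eq_lin_ext[OF sub _ _ _ _ xy], goal_cases)
    case (1 a a' b)
    then show ?case using g1(1)[of b a a'] by (simp add: module_hom.add[OF hom] algebra_simps)
  next
    case (2 a b b')
    show ?case unfolding prod.case lin_ext_fun(1)[OF vector_space_free_scale, symmetric]
      by (rule lin_ext_mem[OF sub]) (auto simp: tensor3_null_gen)
  next
    case (3 c a b)
    then show ?case using g1(2)[of b c a] by (simp add: module_hom.scale[OF hom])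
  next
    case (4 c a b)
    show ?case unfolding prod.case lin_ext_fun[OF vector_space_free_scale, symmetric]
      by (rule lin_ext_mem[OF sub]) (auto simp: tensor3_null_gen)
  qed
  show "tensor3_eq s (id_comul D x) (id_comul D y)"
    unfolding id_comul_def tensor3_eq_def
  proof (rule tensor2_eq_lin_ext[OF sub _ _ _ _ xy], goal_cases)
    case (2 b a a')
    then show ?case using g2(1)[of b a a'] by (simp add: module_hom.add[OF hom] algebra_simps)
  next
    case (1 a b b')
    show ?case unfolding prod.case lin_ext_fun(1)[OF vector_space_free_scale, symmetric]
      by (rule lin_ext_mem[OF sub]) (auto simp: tensor3_null_gen)
  next
    case (4 c b a)
    then show ?case using g2(2)[of b c a] by (simp add: module_hom.scale[OF hom])
  next
    case (3 c a b)
    show ?case unfolding prod.case lin_ext_fun[OF vector_space_free_scale, symmetric]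
      by (rule lin_ext_mem[OF sub]) (auto simp: tensor3_null_gen)
  qed
qed

lemma perm_YB_cong:
  fixes s :: "'k::field \<Rightarrow> 'v::ab_group_add \<Rightarrow> 'v" and x y :: "'v \<times> 'v \<Rightarrow>\<^sub>0 'k"
  assumes m: "bilinear_on s UNIV m" and xy: "tensor2_eq s x y"
  shows "tensor3_eq s (perm_YB m x) (perm_YB m y)"
proof -
  interpret F: vector_space "free_scale :: 'k \<Rightarrow> ('v \<times> 'v \<times> 'v \<Rightarrow>\<^sub>0 'k) \<Rightarrow> _"
    by (rule vector_space_free_scale)
  let ?N = "tensor3_null s"
  note sub = vector_space_free_scale subspace_tensor3_null
  have mm: "m (a + a') b = m a b + m a' b" "m a (b + b') = m a b + m a b'"
    "m (s c a) b = s c (m a b)" "m a (s c b) = s c (m a b)" for a a' b b' c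
    using m by (auto simp: bilinear_on_def linear_map_on_def)
  define g :: "'v \<times> 'v \<Rightarrow> 'v \<times> 'v \<Rightarrow> ('v \<times> 'v \<times> 'v \<Rightarrow>\<^sub>0 'k)" where
    "g = (\<lambda>(a, b) (c, d). gen (a, m b c, d) - gen (a, c, m b d) + gen (m a c, b, d) - gen (m c a, b, d))"
  have YB: "perm_YB m x = lin_ext free_scale (\<lambda>p. lin_ext free_scale (g p) x) x" for x
    by (simp add: perm_YB_def g_def case_prod_unfold)
  have comb: "(p1 - p2 + p3 - p4) - (q1 - q2 + q3 - q4) - (u1 - u2 + u3 - u4) \<in> ?N"
    if "p1 - q1 - u1 \<in> ?N" "p2 - q2 - u2 \<in> ?N" "p3 - q3 - u3 \<in> ?N" "p4 - q4 - u4 \<in> ?N"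
    for p1 p2 p3 p4 q1 q2 q3 q4 u1 u2 u3 u4 :: "'v \<times> 'v \<times> 'v \<Rightarrow>\<^sub>0 'k"
  proof -
    have "(p1 - q1 - u1) - (p2 - q2 - u2) + (p3 - q3 - u3) - (p4 - q4 - u4) \<in> ?N"
      by (rule that F.subspace_add[OF subspace_tensor3_null] F.subspace_diff[OF subspace_tensor3_null])+
    then show ?thesis by (simp add: algebra_simps)
  qed
  have combs: "(p1 - p2 + p3 - p4) - free_scale k (q1 - q2 + q3 - q4) \<in> ?N"
    if "p1 - free_scale k q1 \<in> ?N" "p2 - free_scale k q2 \<in> ?N"
      "p3 - free_scale k q3 \<in> ?N" "p4 - free_scale k q4 \<in> ?N"
    for k and p1 p2 p3 p4 q1 q2 q3 q4 :: "'v \<times> 'v \<times> 'v \<Rightarrow>\<^sub>0 'k"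
    using comb[of p1 "free_scale k q1" 0 p2 "free_scale k q2" 0 p3 "free_scale k q3" 0 p4 "free_scale k q4" 0] that
    by (simp add: F.scale_right_distrib F.scale_right_diff_distrib)
  have g1: "g (a + a', b) q - g (a, b) q - g (a', b) q \<in> ?N"
    "g (a, b + b') q - g (a, b) q - g (a, b') q \<in> ?N"
    "g (s k a, b) q - free_scale k (g (a, b) q) \<in> ?N"
    "g (a, s k b) q - free_scale k (g (a, b) q) \<in> ?N" for a a' b b' k q
    unfolding g_def by (cases q; simp only: prod.case mm; intro comb combs tensor3_null_gen)+
  have g2: "g p (a + a', b) - g p (a, b) - g p (a', b) \<in> ?N"
    "g p (a, b + b') - g p (a, b) - g p (a, b') \<in> ?N"
    "g p (s k a, b) - free_scale k (g p (a, b)) \<in> ?N"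
    "g p (a, s k b) - free_scale k (g p (a, b)) \<in> ?N" for a a' b b' k p
    unfolding g_def by (cases p; simp only: prod.case mm; intro comb combs tensor3_null_gen)+
  have "lin_ext free_scale (\<lambda>p. lin_ext free_scale (g p) x) x
      - lin_ext free_scale (\<lambda>p. lin_ext free_scale (g p) y) x \<in> ?N"
    by (rule lin_ext_cong_mod[OF sub], rule tensor2_eq_lin_ext[OF sub g2 xy])
  moreover have "lin_ext free_scale (\<lambda>p. lin_ext free_scale (g p) y) x
      - lin_ext free_scale (\<lambda>p. lin_ext free_scale (g p) y) y \<in> ?N"
    by (rule tensor2_eq_lin_ext[OF sub _ _ _ _ xy];
        unfold lin_ext_fun[OF vector_space_free_scale, symmetric];
        rule lin_ext_mem[OF sub]; rule g1)
  ultimately have "(lin_ext free_scale (\<lambda>p. lin_ext free_scale (g p) x) x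
      - lin_ext free_scale (\<lambda>p. lin_ext free_scale (g p) y) x)
      + (lin_ext free_scale (\<lambda>p. lin_ext free_scale (g p) y) x
      - lin_ext free_scale (\<lambda>p. lin_ext free_scale (g p) y) y) \<in> ?N"
    by (rule F.subspace_add[OF subspace_tensor3_null])
  then show ?thesis by (simp add: tensor3_eq_def YB)
qed

end

theory Submission
  imports Defs
begin

text \<open>
  Write \<open>T = T\<^sub>r\<close>, \<open>S = T\<^bsub>\<sigma>(r)\<^esub>\<close> and \<open>B = T - S\<close>. Contracting the perm Yang-Baxter equation
  with \<open>f \<otimes> g \<otimes> id\<close> says exactly that \<open>T\<close> is multiplicative for \<open>\<cdot>\<^sub>r\<close>.
  Invariance of \<open>r - \<sigma>(r)\<close> means \<open>R(a) B = B ad\<^sup>*(a)\<close>; since \<open>B\<close> is skew for the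
  pairing, symmetrizing this identity gives \<open>L(a) B = B L\<^sup>*(a)\<close>, and the two together make
  \<open>S\<close> multiplicative as well. As \<open>B\<close> is bijective, \<open>T \<oplus> S\<close> is an injective
  homomorphism, which carries the perm identities back to the dual space, and
  \<open>a = T f - S f\<close> has exactly one solution \<open>f\<close>.
\<close>

section \<open>Injective homomorphisms of perm algebras\<close>

text \<open>Both sides of every required identity lie in \<open>S1\<close> by closure and have equal
  images under \<open>\<phi>\<close>, so injectivity identifies them. Applied to
  \<open>T_sum\<close>, this gives the perm identities on the dual space without computing with
  transposes.\<close>

lemma perm_algebra_pullback:
  assumes s1: "vector_space s1" and S1: "module.subspace s1 S1"
    and m1: "\<And>a b. a \<in> S1 \<Longrightarrow> b \<in> S1 \<Longrightarrow> m1 a b \<in> S1"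
    and P: "perm_algebra s2 S2 m2"
    and lin: "linear_map_on s1 s2 S1 \<phi>" and inj: "inj_on \<phi> S1" and im: "\<phi> ` S1 \<subseteq> S2"
    and hom: "\<And>a b. a \<in> S1 \<Longrightarrow> b \<in> S1 \<Longrightarrow> \<phi> (m1 a b) = m2 (\<phi> a) (\<phi> b)"
  shows "perm_algebra s1 S1 m1"
proof -
  interpret vector_space s1 by fact
  note mem = m1 subspace_add[OF S1] subspace_scale[OF S1] im[THEN subsetD, OF imageI]
  note lin' = lin[unfolded linear_map_on_def]
  note P' = P[unfolded perm_algebra_def bilinear_on_def linear_map_on_def]
  have m2: "m2 (x + y) z = m2 x z + m2 y z" "m2 z (x + y) = m2 z x + m2 z y"
    if "x \<in> S2" "y \<in> S2" "z \<in> S2" for x y z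
    using P' that by blast+
  have m2_scale: "m2 (s2 c x) z = s2 c (m2 x z)" "m2 z (s2 c x) = s2 c (m2 z x)"
    if "x \<in> S2" "z \<in> S2" for x z c
    using P' that by blast+
  have "bilinear_on s1 S1 m1"
    unfolding bilinear_on_def linear_map_on_def
    by (intro conjI ballI allI; rule inj_onD[OF inj]; simp add: mem lin' m2 m2_scale hom)
  moreover have "m1 a (m1 b c) = m1 (m1 a b) c \<and> m1 (m1 a b) c = m1 (m1 b a) c"
    if abc: "a \<in> S1" "b \<in> S1" "c \<in> S1" for a b c
  proof -
    have "m2 (\<phi> a) (m2 (\<phi> b) (\<phi> c)) = m2 (m2 (\<phi> a) (\<phi> b)) (\<phi> c)"
      "m2 (m2 (\<phi> a) (\<phi> b)) (\<phi> c) = m2 (m2 (\<phi> b) (\<phi> a)) (\<phi> c)"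
      using P' abc mem(4) by blast+
    then show ?thesis
      using abc by (intro conjI; intro inj_onD[OF inj]) (simp_all add: mem hom)
  qed
  ultimately show ?thesis
    using s1 S1 m1 by (simp add: perm_algebra_def)
qed

lemma perm_subalgebra_image:
  assumes s1: "vector_space s1" and S1: "module.subspace s1 S1"
    and m1: "\<And>a b. a \<in> S1 \<Longrightarrow> b \<in> S1 \<Longrightarrow> m1 a b \<in> S1"
    and P: "perm_algebra s2 S2 m2"
    and lin: "linear_map_on s1 s2 S1 \<phi>" and im: "\<phi> ` S1 \<subseteq> S2"
    and hom: "\<And>a b. a \<in> S1 \<Longrightarrow> b \<in> S1 \<Longrightarrow> \<phi> (m1 a b) = m2 (\<phi> a) (\<phi> b)"
  shows "perm_subalgebra s2 S2 m2 (\<phi> ` S1)"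
proof -
  interpret v1: vector_space s1 by fact
  interpret v2: vector_space s2 using P by (simp add: perm_algebra_def)
  note lin' = lin[unfolded linear_map_on_def]
  have "\<phi> 0 = 0"
    \<comment> \<open>\<open>\<phi>\<close> is additive only on \<open>S1\<close>, so its value at 0
      is read off from 0 + 0 = 0 inside \<open>S1\<close>.\<close>
    using lin' v1.subspace_0[OF S1] by (metis add_0 add_cancel_right_right)
  then have "v2.subspace (\<phi> ` S1)"
    unfolding v2.subspace_def using lin' v1.subspace_0[OF S1] v1.subspace_add[OF S1] v1.subspace_scale[OF S1]
    by (auto simp: image_iff) metis+
  moreover have "\<forall>a\<in>\<phi> ` S1. \<forall>b\<in>\<phi> ` S1. m2 a b \<in> \<phi> ` S1"
    using hom m1 by (auto simp: image_iff) metis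
  ultimately show ?thesis
    using P im by (simp add: perm_subalgebra_def)
qed

text \<open>The isomorphism runs from the image back to the source, so the witness is the inverse of
  \<open>\<phi>\<close> on its image.\<close>

lemma perm_isomorphic_image:
  assumes s1: "vector_space s1" and S1: "module.subspace s1 S1"
    and m1: "\<And>a b. a \<in> S1 \<Longrightarrow> b \<in> S1 \<Longrightarrow> m1 a b \<in> S1"
    and lin: "linear_map_on s1 s2 S1 \<phi>" and inj: "inj_on \<phi> S1"
    and hom: "\<And>a b. a \<in> S1 \<Longrightarrow> b \<in> S1 \<Longrightarrow> \<phi> (m1 a b) = m2 (\<phi> a) (\<phi> b)"
  shows "perm_isomorphic s2 (\<phi> ` S1) m2 s1 S1 m1"
proof -
  interpret vector_space s1 by fact
  note lin' = lin[unfolded linear_map_on_def]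
  let ?g = "inv_into S1 \<phi>"
  have g: "?g y = x" if "x \<in> S1" "y = \<phi> x" for x y
    using that inj by simp
  have "linear_map_on s2 s1 (\<phi> ` S1) ?g"
    unfolding linear_map_on_def using inj lin' subspace_add[OF S1] subspace_scale[OF S1]
    by (auto intro!: g)
  moreover have "?g (m2 a b) = m1 (?g a) (?g b)" if "a \<in> \<phi> ` S1" "b \<in> \<phi> ` S1" for a b
    using that inj m1 hom by (auto intro!: g)
  ultimately show ?thesis
    unfolding perm_isomorphic_def using inj by (blast intro: inj_on_imp_bij_betw bij_betw_inv_into)
qed

lemma perm_algebra_sum:
  assumes "perm_algebra s UNIV m"
  shows "perm_algebra (prod_scale s) UNIV (sum_mult m)"
proof -
  note P = assms[unfolded perm_algebra_def bilinear_on_def linear_map_on_def, simplified]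
  interpret vector_space s using P by simp
  interpret p: vector_space "prod_scale s"
    by unfold_locales (auto simp: prod_scale_def scale_left_distrib scale_right_distrib)
  have "m (m a b) c = m a (m b c)" "m (m b a) c = m a (m b c)" for a b c
    using P by metis+
  moreover have "m (a + b) c = m a c + m b c" "m a (b + c) = m a b + m a c"
    "m (s k a) b = s k (m a b)" "m a (s k b) = s k (m a b)" for a b c k
    using P by blast+
  ultimately show ?thesis
    using p.vector_space_axioms
    by (simp add: perm_algebra_def bilinear_on_def linear_map_on_def sum_mult_def prod_scale_def)
qed

section \<open>Contractions of tensors\<close>

text \<open>Exchange of two finite sums. It serves to reorder the double sum over the terms of
  \<open>r\<close> in the Yang-Baxter element.\<close>

lemma lin_ext_swap:
  assumes "vector_space s"
  shows "lin_ext s (\<lambda>p. lin_ext s (\<lambda>q. F p q) y) x = lin_ext s (\<lambda>q. lin_ext s (\<lambda>p. F p q) x) y"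
proof -
  interpret vector_space s by fact
  show ?thesis
    by (simp add: lin_ext_def scale_sum_right mult.commute) (rule sum.swap)
qed

lemma lin_ext_fun_add:
  assumes "vector_space s"
  shows "lin_ext s (\<lambda>p. F p + G p) x = lin_ext s F x + lin_ext s G x"
proof -
  interpret vector_space s by fact
  show ?thesis by (simp add: lin_ext_def scale_right_distrib sum.distrib)
qed

lemma lin_ext_compose:
  assumes s: "vector_space s" and h: "Vector_Spaces.linear s t h"
  shows "h (lin_ext s f x) = lin_ext t (\<lambda>p. h (f p)) x"
proof -
  interpret h: Vector_Spaces.linear s t h by fact
  show ?thesis by (simp add: lin_ext_def h.sum h.scale)
qed

lemma lin_ext_lin_ext_free:
  assumes "vector_space t"
  shows "lin_ext t f (lin_ext free_scale g x) = lin_ext t (\<lambda>p. lin_ext t f (g p)) x"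
  by (rule lin_ext_compose[OF vector_space_free_scale linear_lin_ext[OF assms]])

section \<open>The dual space and transposes\<close>

lemma vector_space_fun_scale: "vector_space (fun_scale :: 'k::field \<Rightarrow> ('v \<Rightarrow> 'k) \<Rightarrow> _)"
  by unfold_locales (auto simp: fun_scale_def fun_eq_iff algebra_simps)

lemma vector_space_times: "vector_space ((*) :: 'k::field \<Rightarrow> 'k \<Rightarrow> 'k)"
  by unfold_locales (auto simp: algebra_simps)

lemma linear_iff_on_UNIV:
  assumes "vector_space s1" "vector_space s2"
  shows "Vector_Spaces.linear s1 s2 f \<longleftrightarrow> linear_map_on s1 s2 UNIV f"
  using assms
  by (auto simp: linear_map_on_def Vector_Spaces.linear_def module_hom_def module_hom_axioms_def
      module_def vector_space_def)

lemma dual_space_iff: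
  assumes "vector_space s"
  shows "f \<in> dual_space s \<longleftrightarrow> (\<forall>x y. f (x + y) = f x + f y) \<and> (\<forall>c x. f (s c x) = c * f x)"
  unfolding dual_space_def mem_Collect_eq linear_iff_on_UNIV[OF assms vector_space_times]
  by (simp add: linear_map_on_def)

lemma dual_space_diff:
  assumes "f \<in> dual_space s"
  shows "f (x - y) = f x - f y"
  using assms by (simp add: dual_space_def module_hom.diff[OF linear_imp_module_hom])

lemma subspace_dual_space:
  assumes "vector_space s"
  shows "module.subspace fun_scale (dual_space s)"
proof -
  interpret f: vector_space fun_scale by (rule vector_space_fun_scale)
  show ?thesis
    unfolding f.subspace_def by (auto simp: dual_space_iff[OF assms] fun_scale_def algebra_simps)
qed

lemma dual_space_comp:
  assumes "f \<in> dual_space s" "Vector_Spaces.linear s s g"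
  shows "transpose_op g f \<in> dual_space s"
  using Vector_Spaces.linear_compose[of s s g "(*)" f] assms
  by (simp add: dual_space_def transpose_op_def o_def)

section \<open>The operator attached to a tensor\<close>

lemma T_map_linear:
  assumes s: "vector_space s"
  shows "T_map s x (f + g) = T_map s x f + T_map s x g"
    and "T_map s x (fun_scale c f) = s c (T_map s x f)"
    and "T_map s (x - y) f = T_map s x f - T_map s y f"
    and "T_map s (free_scale c x) f = s c (T_map s x f)"
    and "T_map s 0 f = 0"
proof -
  interpret vector_space s by fact
  interpret l: Vector_Spaces.linear free_scale s "lin_ext s h" for h by (rule linear_lin_ext[OF s])
  show "T_map s x (f + g) = T_map s x f + T_map s x g"
    and "T_map s x (fun_scale c f) = s c (T_map s x f)"
    by (simp_all add: T_map_def lin_ext_def case_prod_unfold fun_scale_def scale_left_distrib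
        scale_right_distrib sum.distrib scale_sum_right mult_ac)
  show "T_map s (x - y) f = T_map s x f - T_map s y f"
    and "T_map s (free_scale c x) f = s c (T_map s x f)"
    and "T_map s 0 f = 0"
    by (simp_all add: T_map_def l.diff l.scale l.zero)
qed

text \<open>The functional contracts the first leg, so \<open>g\<close> moves onto it as a
  transpose, while \<open>h\<close> acts on the surviving second leg.\<close>

lemma T_map_tmap:
  assumes s: "vector_space s" and h: "Vector_Spaces.linear s s h"
  shows "T_map s (tmap g h x) f = h (T_map s x (transpose_op g f))"
proof -
  interpret h: Vector_Spaces.linear s s h by fact
  show ?thesis
    unfolding T_map_def tmap_def lin_ext_lin_ext_free[OF s] lin_ext_compose[OF s h]
    by (simp add: case_prod_unfold lin_ext_gen[OF s] h.scale transpose_op_def)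
qed

lemma T_map_tflip:
  assumes "vector_space s"
  shows "T_map s (tflip x) f = lin_ext s (\<lambda>(a, b). s (f b) a) x"
  by (simp add: T_map_def tflip_def lin_ext_lin_ext_free[OF assms] case_prod_unfold lin_ext_gen[OF assms])

text \<open>Both sides contract \<open>x\<close> with \<open>f\<close> on the first leg and
  \<open>h\<close> on the second. Thus the flip of a tensor corresponds to the transposed operator,
  which is the source of the skewness of \<open>B\<close>.\<close>

lemma dual_T_map:
  assumes s: "vector_space s" and f: "f \<in> dual_space s" and h: "h \<in> dual_space s"
  shows "h (T_map s x f) = f (T_map s (tflip x) h)"
proof -
  have lin: "Vector_Spaces.linear s (*) f" "Vector_Spaces.linear s (*) h"
    using f h by (auto simp: dual_space_def)
  note fh = f[unfolded dual_space_iff[OF s]] h[unfolded dual_space_iff[OF s]]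
  show ?thesis
    unfolding T_map_tflip[OF s] unfolding T_map_def lin_ext_compose[OF s lin(1)] lin_ext_compose[OF s lin(2)]
    by (simp add: case_prod_unfold fh mult.commute)
qed

section \<open>Multiplicativity\<close>

lemma perm_algebra_ops_linear:
  assumes "perm_algebra s UNIV m"
  shows "Vector_Spaces.linear s s (L_op m a)" "Vector_Spaces.linear s s (R_op m a)"
    "Vector_Spaces.linear s s (ad_op m a)"
proof -
  have s: "vector_space s" using assms by (simp add: perm_algebra_def)
  interpret vector_space s by fact
  show "Vector_Spaces.linear s s (L_op m a)" "Vector_Spaces.linear s s (R_op m a)"
    "Vector_Spaces.linear s s (ad_op m a)"
    unfolding linear_iff_on_UNIV[OF s s] using assms
    by (auto simp: perm_algebra_def bilinear_on_def linear_map_on_def L_op_def R_op_def ad_op_def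
        scale_right_diff_distrib)
qed

lemma dual_mult_mem:
  assumes P: "perm_algebra s UNIV m" and "f \<in> dual_space s" "g \<in> dual_space s"
  shows "dual_mult s m r f g \<in> dual_space s"
proof -
  have s: "vector_space s" using P by (simp add: perm_algebra_def)
  interpret f: vector_space fun_scale by (rule vector_space_fun_scale)
  show ?thesis
    unfolding dual_mult_def
    by (intro f.subspace_add[OF subspace_dual_space[OF s]] dual_space_comp perm_algebra_ops_linear[OF P] assms)
qed

text \<open>After contraction of the first two legs with \<open>f\<close> and \<open>g\<close>, the
  first term of the Yang-Baxter element becomes T applied to the L part of the product, the second
  becomes the product of T f and T g, and the last two together become T applied to the ad
  part.\<close>

lemma T_map_dual_mult:
  assumes P: "perm_algebra s UNIV m" and YB: "perm_YBE_solution s m r"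
    and f: "f \<in> dual_space s" and g: "g \<in> dual_space s"
  shows "T_map s r (dual_mult s m r f g) = m (T_map s r f) (T_map s r g)"
proof -
  have s: "vector_space s" using P by (simp add: perm_algebra_def)
  interpret vector_space s by fact
  note fg = f[unfolded dual_space_iff[OF s]] g[unfolded dual_space_iff[OF s]]
  note lin_mult = perm_algebra_ops_linear(1)[OF P, unfolded L_op_def[abs_def]]
  note mm = P[unfolded perm_algebra_def bilinear_on_def linear_map_on_def, simplified]
  let ?c = "\<lambda>p. s (f (fst p) * g (fst (snd p))) (snd (snd p))"
  \<comment> \<open>The contraction \<open>?c\<close> is trilinear, so it respects equality of
    tensors; with the subspace \<open>{0}\<close> the congruence turns into an equation in the
    algebra.\<close>
  have "lin_ext s ?c (perm_YB m r) - lin_ext s ?c 0 \<in> {0}"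
    by (rule tensor3_eq_lin_ext[OF s _ _ _ _ _ _ _ YB[unfolded perm_YBE_solution_def]])
      (auto simp: subspace_single_0 fg distrib_left distrib_right scale_left_distrib scale_right_distrib mult_ac)
  then have "lin_ext s ?c (perm_YB m r) = 0"
    by (simp add: lin_ext_def)
  moreover interpret c: Vector_Spaces.linear free_scale s "lin_ext s ?c" by (rule linear_lin_ext[OF s])
  have "lin_ext s ?c (perm_YB m r) = lin_ext s (\<lambda>(a, b). lin_ext s (\<lambda>(c, d).
      s (f a) (s (g (m b c)) d) - s (f a) (s (g c) (m b d))
      + s (f (m a c)) (s (g b) d) - s (f (m c a)) (s (g b) d)) r) r"
    unfolding perm_YB_def
    by (simp add: lin_ext_lin_ext_free[OF s] case_prod_unfold c.add c.diff lin_ext_gen[OF s])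
  ultimately have "lin_ext s (\<lambda>(a, b). lin_ext s (\<lambda>(c, d).
      s (f a) (s (g (m b c)) d) - s (f a) (s (g c) (m b d))
      + s (f (m a c)) (s (g b) d) - s (f (m c a)) (s (g b) d)) r) r = 0"
    by simp
  \<comment> \<open>With \<open>(c, d)\<close> fixed, the sum over \<open>(a, b)\<close> can be
    evaluated first: weights \<open>f a\<close> on \<open>b\<close> sum to T f, and weights
    \<open>g b\<close> on \<open>a\<close> sum to S g.\<close>
  then have YB0: "lin_ext s (\<lambda>(c, d). lin_ext s (\<lambda>(a, b).
      s (f a) (s (g (m b c)) d) - s (f a) (s (g c) (m b d))
      + s (f (m a c)) (s (g b) d) - s (f (m c a)) (s (g b) d)) r) r = 0"
    unfolding case_prod_unfold by (subst lin_ext_swap[OF s])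
  let ?T = "T_map s r f" and ?S = "T_map s (tflip r) g"
  have inner: "lin_ext s (\<lambda>(a, b).
      s (f a) (s (g (m b c)) d) - s (f a) (s (g c) (m b d))
      + s (f (m a c)) (s (g b) d) - s (f (m c a)) (s (g b) d)) r =
    s (g (m ?T c)) d - s (g c) (m ?T d) + s (f (m ?S c)) d - s (f (m c ?S)) d" for c d
  proof -
    \<comment> \<open>Each of the four terms is a linear function of \<open>z\<close>, evaluated at
      T f or S g; linearity moves it inside the defining sum.\<close>
    have l: "Vector_Spaces.linear s s (\<lambda>z. s (g (m z c)) d)"
      "Vector_Spaces.linear s s (\<lambda>z. s (g c) (m z d))"
      "Vector_Spaces.linear s s (\<lambda>z. s (f (m z c)) d)"
      "Vector_Spaces.linear s s (\<lambda>z. s (f (m c z)) d)"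
      unfolding linear_iff_on_UNIV[OF s s]
      by (simp_all add: linear_map_on_def mm fg scale_left_distrib scale_right_distrib mult_ac)
    show ?thesis
      unfolding T_map_tflip[OF s] unfolding T_map_def
        lin_ext_compose[OF s l(1)] lin_ext_compose[OF s l(2)]
        lin_ext_compose[OF s l(3)] lin_ext_compose[OF s l(4)]
        lin_ext_fun[OF s, symmetric] lin_ext_fun_add[OF s, symmetric]
      by (rule arg_cong[where f = "\<lambda>h. lin_ext s h r"])
        (simp add: fun_eq_iff case_prod_unfold mm fg mult_ac)
  qed
  have "T_map s r (dual_mult s m r f g) =
      lin_ext s (\<lambda>(c, d). s (g (m ?T c)) d + s (f (m ?S c)) d - s (f (m c ?S)) d) r"
    unfolding T_map_def[of s r "dual_mult s m r f g"] unfolding dual_mult_def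
    by (simp add: case_prod_unfold transpose_op_def L_op_def R_op_def ad_op_def dual_space_diff[OF f]
        scale_left_distrib scale_left_diff_distrib add_diff_eq)
  moreover have "m ?T (T_map s r g) = lin_ext s (\<lambda>(c, d). s (g c) (m ?T d)) r"
    unfolding T_map_def[of s r g] lin_ext_compose[OF s lin_mult] by (simp add: case_prod_unfold mm)
  moreover have "lin_ext s (\<lambda>(c, d). s (g (m ?T c)) d + s (f (m ?S c)) d - s (f (m c ?S)) d) r
      - lin_ext s (\<lambda>(c, d). s (g c) (m ?T d)) r = 0"
    unfolding lin_ext_fun(1)[OF s, symmetric] using YB0[unfolded inner]
    by (simp add: case_prod_unfold algebra_simps)
  ultimately show ?thesis by simp
qed

text \<open>In the invariance relation R(a) acts on the output leg of \<open>x\<close> and ad(a) on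
  the contracted leg, so the latter reappears as a transpose on \<open>f\<close>.\<close>

lemma T_map_R_ad_invariant:
  assumes P: "perm_algebra s UNIV m" and x: "tensor2_eq s (R_ad_action m a x) 0"
    and f: "f \<in> dual_space s"
  shows "m (T_map s x f) a = T_map s x (transpose_op (ad_op m a) f)"
proof -
  have s: "vector_space s" using P by (simp add: perm_algebra_def)
  have id: "Vector_Spaces.linear s s id" by (rule vector_space.linear_id[OF s])
  have "T_map s (R_ad_action m a x) f = 0"
    using T_map_cong[OF s f x] by (simp add: T_map_linear[OF s])
  then show ?thesis
    by (simp add: R_ad_action_def T_map_linear(3)[OF s] T_map_tmap[OF s perm_algebra_ops_linear(2)[OF P]]
        T_map_tmap[OF s id] transpose_op_def R_op_def)
qed

text \<open>Functionals separate points here because \<open>B\<close> is onto and skew: if every functional kills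
  \<open>B k\<close>, then \<open>k\<close> vanishes on the range of \<open>B\<close>.\<close>

lemma T_map_L_invariant:
  assumes P: "perm_algebra s UNIV m"
    and inv: "\<And>a f. f \<in> dual_space s \<Longrightarrow> m (B f) a = B (transpose_op (ad_op m a) f)"
    and skew: "\<forall>f\<in>dual_space s. \<forall>h\<in>dual_space s. h (B f) = - f (B h)"
    and bij: "bij_betw B (dual_space s) UNIV" and B0: "B 0 = 0"
    and g: "g \<in> dual_space s"
  shows "m a (B g) = B (transpose_op (L_op m a) g)"
proof -
  have s: "vector_space s" using P by (simp add: perm_algebra_def)
  have tr: "transpose_op (L_op m a) h \<in> dual_space s" "transpose_op (ad_op m a) h \<in> dual_space s"
    if "h \<in> dual_space s" for h a
    by (intro dual_space_comp perm_algebra_ops_linear[OF P] that)+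
  \<comment> \<open>Pair \<open>inv\<close> with \<open>h\<close> and move \<open>B\<close> across
    by skewness, so that ad(a) acts on \<open>B h\<close> inside \<open>f\<close>.\<close>
  have ad: "h (m (B f) a) = f (m (B h) a) - f (m a (B h))"
    if "f \<in> dual_space s" "h \<in> dual_space s" for f h
    unfolding inv[OF that(1)] skew[rule_format, OF tr(2)[OF that(1)] that(2)]
    by (simp add: dual_space_diff[OF that(1)] transpose_op_def ad_op_def L_op_def R_op_def)
  \<comment> \<open>By skewness the claim says that h(a B g) + g(a B h) vanishes. Adding
    \<open>ad\<close> for \<open>(h, g)\<close> to \<open>ad\<close> for \<open>(g, h)\<close>
    cancels the right multiplications and leaves exactly this.\<close>
  have L: "h (m a (B g) - B (transpose_op (L_op m a) g)) = 0" if h: "h \<in> dual_space s" for h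
    unfolding dual_space_diff[OF h] skew[rule_format, OF tr(1)[OF g] h]
    using ad[OF h g] ad[OF g h] by (simp add: transpose_op_def L_op_def)
  obtain k where k: "k \<in> dual_space s" "B k = m a (B g) - B (transpose_op (L_op m a) g)"
    using bij by (metis UNIV_I bij_betwE bij_betw_inv_into f_inv_into_f bij_betw_imp_surj_on)
  have "k y = 0" for y
  proof -
    obtain h where "h \<in> dual_space s" "y = B h"
      using bij by (metis UNIV_I image_iff bij_betw_imp_surj_on)
    then show ?thesis using L skew k by (metis neg_equal_0_iff_equal)
  qed
  then have "k = 0" by (simp add: fun_eq_iff)
  then show ?thesis using k(2) B0 by simp
qed

text \<open>The two invariance rules turn \<open>B\<close> of the dual product into T f B g + B f S
  g. Since B = T - S, this telescopes to T f T g - S f S g, and multiplicativity of T leaves that of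
  S.\<close>

lemma T_map_tflip_dual_mult:
  assumes P: "perm_algebra s UNIV m" and YB: "perm_YBE_solution s m r"
    and inv: "\<And>a. tensor2_eq s (R_ad_action m a (r - tflip r)) 0"
    and bij: "bij_betw (T_map s (r - tflip r)) (dual_space s) UNIV"
    and f: "f \<in> dual_space s" and g: "g \<in> dual_space s"
  shows "T_map s (tflip r) (dual_mult s m r f g) = m (T_map s (tflip r) f) (T_map s (tflip r) g)"
proof -
  have s: "vector_space s" using P by (simp add: perm_algebra_def)
  interpret vector_space s by fact
  let ?T = "T_map s r" and ?S = "T_map s (tflip r)" and ?B = "T_map s (r - tflip r)"
  have BTS: "?B h = ?T h - ?S h" for h by (simp add: T_map_linear[OF s])
  note invB = T_map_R_ad_invariant[OF P inv]
  have skew: "\<forall>f\<in>dual_space s. \<forall>h\<in>dual_space s. h (?B f) = - f (?B h)"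
  proof (intro ballI)
    fix f h assume fh: "f \<in> dual_space s" "h \<in> dual_space s"
    show "h (?B f) = - f (?B h)"
      using dual_T_map[OF s fh, of r] dual_T_map[OF s fh(2,1), of r]
      by (simp add: BTS dual_space_diff[OF fh(1)] dual_space_diff[OF fh(2)])
  qed
  have B0: "?B 0 = 0"
    using T_map_linear(2)[OF s, of "r - tflip r" 0 0] by (simp add: fun_scale_def zero_fun_def)
  have LB: "m a (?B g) = ?B (transpose_op (L_op m a) g)" for a
    by (rule T_map_L_invariant[OF P invB skew bij B0 g])
  have "?B (dual_mult s m r f g) = m (?T f) (?B g) + m (?B f) (?S g)"
    unfolding dual_mult_def T_map_linear(1)[OF s] LB invB[OF f] ..
  moreover have "m (x - y) z = m x z - m y z" "m z (x - y) = m z x - m z y" for x y z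
    using module_hom.diff[OF linear_imp_module_hom[OF perm_algebra_ops_linear(2)[OF P]]]
      module_hom.diff[OF linear_imp_module_hom[OF perm_algebra_ops_linear(1)[OF P]]]
    by (simp_all add: L_op_def R_op_def)
  ultimately show ?thesis
    using T_map_dual_mult[OF P YB f g] by (simp add: BTS algebra_simps)
qed

section \<open>Transport along the injective homomorphism and unique decomposition\<close>

theorem proposition3p4:
  fixes s :: "'k::field_char_0 \<Rightarrow> 'v::ab_group_add \<Rightarrow> 'v"
    and Basis :: "'v set"
    and m :: "'v \<Rightarrow> 'v \<Rightarrow> 'v"
    and r :: "'v \<times> 'v \<Rightarrow>\<^sub>0 'k"
  assumes "finite_dimensional_vector_space s Basis"
    and "factorizable_perm_bialgebra s m r"
  shows "perm_subalgebra (prod_scale s) UNIV (sum_mult m) (T_sum s r ` dual_space s)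
    \<and> perm_algebra fun_scale (dual_space s) (dual_mult s m r)
    \<and> perm_isomorphic (prod_scale s) (T_sum s r ` dual_space s) (sum_mult m)
        fun_scale (dual_space s) (dual_mult s m r)
    \<and> (\<forall>a. \<exists>!p. p \<in> T_sum s r ` dual_space s \<and> a = fst p - snd p)"
proof -
  have P: "perm_algebra s UNIV m" and YB: "perm_YBE_solution s m r"
    and inv: "R_ad_invariant s m (free_scale (1/2) (r - tflip r))"
    and bij: "bij_betw (T_map s (r - tflip r)) (dual_space s) UNIV"
    using assms(2)
    by (auto simp: factorizable_perm_bialgebra_def quasi_triangular_perm_bialgebra_def perm_bialgebra_def)
  have s: "vector_space s" using P by (simp add: perm_algebra_def)
  let ?D = "dual_space s" and ?B = "T_map s (r - tflip r)"
  have inv': "tensor2_eq s (R_ad_action m a (r - tflip r)) 0" for a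
  proof -
    interpret F: vector_space "free_scale :: 'k \<Rightarrow> ('v \<times> 'v \<Rightarrow>\<^sub>0 'k) \<Rightarrow> _"
      by (rule vector_space_free_scale)
    interpret l: Vector_Spaces.linear free_scale free_scale
      "tmap f g :: ('v \<times> 'v \<Rightarrow>\<^sub>0 'k) \<Rightarrow> _" for f g
      unfolding tmap_def by (rule linear_lin_ext[OF vector_space_free_scale])
    \<comment> \<open>The action is linear in the tensor, so the factor 1/2 comes out; multiplying
      by 2 removes it, as 2 is nonzero in characteristic zero.\<close>
    have "free_scale (1/2) (R_ad_action m a (r - tflip r)) \<in> tensor2_null s"
      using inv unfolding R_ad_invariant_def tensor2_eq_def R_ad_action_def l.scale
        F.scale_right_diff_distrib[symmetric] by simp
    from F.subspace_scale[OF subspace_tensor2_null this, of 2] show ?thesis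
      by (simp add: tensor2_eq_def)
  qed
  have BTS: "?B f = fst (T_sum s r f) - snd (T_sum s r f)" for f
    by (simp add: T_sum_def T_map_linear[OF s])
  \<comment> \<open>Equal pairs have equal component differences, that is, equal values of
    \<open>?B\<close>, which is injective.\<close>
  have inj: "inj_on (T_sum s r) ?D"
    using bij unfolding bij_betw_def inj_on_def BTS by metis
  have lin: "linear_map_on fun_scale (prod_scale s) ?D (T_sum s r)"
    by (simp add: linear_map_on_def T_sum_def prod_scale_def T_map_linear[OF s])
  have hom: "T_sum s r (dual_mult s m r f g) = sum_mult m (T_sum s r f) (T_sum s r g)"
    if "f \<in> ?D" "g \<in> ?D" for f g
    using T_map_dual_mult[OF P YB that] T_map_tflip_dual_mult[OF P YB inv' bij that]
    by (simp add: T_sum_def sum_mult_def)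
  note D = vector_space_fun_scale subspace_dual_space[OF s] dual_mult_mem[OF P]
  let ?\<phi> = "T_sum s r" and ?m = "dual_mult s m r" and ?m' = "sum_mult m"
  note PP = perm_algebra_sum[OF P]
  have "\<exists>!p. p \<in> T_sum s r ` ?D \<and> a = fst p - snd p" for a
  proof -
    obtain f where "f \<in> ?D" "a = ?B f"
      using bij by (metis UNIV_I image_iff bij_betw_imp_surj_on)
    \<comment> \<open>A pair in the image with difference \<open>a\<close> is
      \<open>T_sum s r g\<close> with \<open>?B g = a\<close>, so uniqueness of the pair reduces to
      uniqueness of the functional.\<close>
    moreover have "g = f" if "g \<in> ?D" "?B g = ?B f" "f \<in> ?D" for g f
      using that bij by (metis bij_betw_def inj_onD)
    ultimately show ?thesis unfolding BTS by (intro ex1I[of _ "T_sum s r f"]; blast)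
  qed
  moreover have "perm_subalgebra (prod_scale s) UNIV (sum_mult m) (T_sum s r ` ?D)"
    by (rule perm_subalgebra_image[where \<phi> = ?\<phi> and ?m1.0 = ?m and ?m2.0 = ?m', OF D PP lin _ hom]) auto
  moreover have "perm_algebra fun_scale ?D (dual_mult s m r)"
    by (rule perm_algebra_pullback[where \<phi> = ?\<phi> and ?m1.0 = ?m and ?m2.0 = ?m', OF D PP lin inj _ hom]) auto
  moreover have "perm_isomorphic (prod_scale s) (T_sum s r ` ?D) (sum_mult m)
      fun_scale ?D (dual_mult s m r)"
    by (rule perm_isomorphic_image[where \<phi> = ?\<phi> and ?m1.0 = ?m and ?m2.0 = ?m', OF D lin inj hom])
  ultimately show ?thesis by blast
qed

end
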